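(* Let $q>1$. Then for every pair of weights $(v_1,v_2)\in A_{\vec{\frac12}}$ on $\mathbb R^n$ there is a constant $C$, depending only on $n$, $q$ and $(v_1,v_2)$, such that for all measurable functions $f_1,f_2$ on $\mathbb R^n$ $$\|N(f_1,f_2)\|_{L^{\frac12,\infty}(v_1^{1/2}v_2^{1/2})}\le C\prod_{i=1}^2\|f_i\|_{L^{1,\frac1{2q}}(v_i)}.$$
   Context: The operator $N$ is defined by $$N(f,g)(x)=\sup_{\lambda>0}\lambda\,\Big|\Big\{y\in\mathbb R^n\setminus\{0\}:\frac{|f(x+y)|\,|g(x+y)|}{|y|^{2n}}>\lambda\Big\}\Big|^2 ,$$ where $|\cdot|$ of a set is Lebesgue measure. A weight is an a.e. positive measurable function, identified with the measure $w\,dx$. A pair of weights $(v_1,v_2)$ belongs to $A_{\vec{\frac12}}$ if $$\sup_Q\Big(\frac1{|Q|}\int_Q v_1^{1/2}v_2^{1/2}\Big)^2\prod_{i=1}^2\operatorname{ess\,sup}_Q v_i^{-1}<\infty,$$ supremum over all cubes $Q\subset\mathbb R^n$. Lorentz quasi-norms: $\|f\|_{L^{p,\alpha}(w)}=\big(p\int_0^\infty s^{\alpha-1}\,w(\{|f|>s\})^{\alpha/p}\,ds\big)^{1/\alpha}$ for $0<p,\alpha<\infty$ (other usual normalizations differ by a constant factor), and $\|f\|_{L^{p,\infty}(w)}=\sup_{t>0}t\,w(\{|f|>t\})^{1/p}$. The convention $0\cdot\infty=\infty$ is used on the right-hand side. *)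

theory Defs
  imports "HOL-Analysis.Analysis" "HOL-Probability.Essential_Supremum"
begin

(* Powers on [0, \<infinity>] with exponent a > 0: \<infinity> powr a = \<infinity> and 0 powr a = 0. *)
definition ennpowr :: "ennreal \<Rightarrow> real \<Rightarrow> ennreal" where
  "ennpowr x a = (if x = \<infinity> then \<infinity> else ennreal (enn2real x powr a))"

(* Product on [0, \<infinity>] with the convention 0 * \<infinity> = \<infinity>; the library product has 0 * \<infinity> = 0. *)
definition times_inf :: "ennreal \<Rightarrow> ennreal \<Rightarrow> ennreal" where
  "times_inf a b = (if a = \<infinity> \<or> b = \<infinity> then \<infinity> else a * b)"

(* For measurable f and g this is a supremum of lower semicontinuous functions of x (Fatou), so its
   level sets are measurable and emeasure is meaningful on them. *)
definition N_op :: "(real^'n \<Rightarrow> complex) \<Rightarrow> (real^'n \<Rightarrow> complex) \<Rightarrow> real^'n \<Rightarrow> ennreal" where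
  "N_op f g x =
     (SUP t\<in>{0<..}. ennreal t *
        (emeasure lebesgue
          {y. y \<noteq> 0 \<and> cmod (f (x + y)) * cmod (g (x + y)) / norm y ^ (2 * CARD('n)) > t})\<^sup>2)"

definition is_weight :: "(real^'n \<Rightarrow> real) \<Rightarrow> bool" where
  "is_weight w \<longleftrightarrow> w \<in> borel_measurable lebesgue \<and> (AE x in lebesgue. 0 < w x)"

definition weight_measure :: "(real^'n \<Rightarrow> real) \<Rightarrow> (real^'n) measure" where
  "weight_measure w = density lebesgue (\<lambda>x. ennreal (w x))"

definition geom_weight :: "(real^'n \<Rightarrow> real) \<Rightarrow> (real^'n \<Rightarrow> real) \<Rightarrow> real^'n \<Rightarrow> real" where
  "geom_weight v1 v2 x = v1 x powr (1/2) * v2 x powr (1/2)"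

definition cubes :: "(real^'n) set set" where
  "cubes = {cbox a (a + vec l) | a l. 0 < l}"

definition A_half :: "(real^'n \<Rightarrow> real) \<Rightarrow> (real^'n \<Rightarrow> real) \<Rightarrow> bool" where
  "A_half v1 v2 \<longleftrightarrow> is_weight v1 \<and> is_weight v2 \<and>
     (SUP Q\<in>cubes.
        ((\<integral>\<^sup>+x\<in>Q. ennreal (geom_weight v1 v2 x) \<partial>lebesgue) / emeasure lebesgue Q)\<^sup>2
        * esssup (lebesgue_on Q) (\<lambda>x. inverse (ennreal (v1 x)))
        * esssup (lebesgue_on Q) (\<lambda>x. inverse (ennreal (v2 x)))) < \<infinity>"

(* The quasi-norms depend on a function only through its modulus F, which takes values in
   [0, \<infinity>] because N_op does. *)
definition lorentz ::
    "real \<Rightarrow> real \<Rightarrow> (real^'n \<Rightarrow> real) \<Rightarrow> (real^'n \<Rightarrow> ennreal) \<Rightarrow> ennreal" where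
  "lorentz p \<alpha> w F =
     ennpowr (ennreal p *
       (\<integral>\<^sup>+s\<in>{0<..}. ennreal (s powr (\<alpha> - 1)) *
          ennpowr (emeasure (weight_measure w) {x. F x > ennreal s}) (\<alpha> / p) \<partial>lborel))
       (1 / \<alpha>)"

definition weak_lorentz ::
    "real \<Rightarrow> (real^'n \<Rightarrow> real) \<Rightarrow> (real^'n \<Rightarrow> ennreal) \<Rightarrow> ennreal" where
  "weak_lorentz p w F =
     (SUP t\<in>{0<..}. ennreal t *
        ennpowr (emeasure (weight_measure w) {x. F x > ennreal t}) (1 / p))"

end

theory Submission
  imports Defs
begin

text \<open>Put \<open>h = \<bar>f\<^sub>1 f\<^sub>2\<bar>\<^sup>1\<^sup>/\<^sup>2\<close>, so that \<open>N(f\<^sub>1, f\<^sub>2)\<close> is the square of the weak \<open>L\<^sup>1\<close> norm of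
  \<open>y \<mapsto> h(x + y) / \<bar>y\<bar>\<^sup>n\<close>. That norm is subadditive over functions of disjoint support, and for an
  indicator function of a set \<open>E\<close> it is the maximal function of \<open>E\<close> over balls. Splitting along the dyadic level sets
  \<open>E\<^sub>j\<^sub>k\<close> of \<open>(\<bar>f\<^sub>1\<bar>, \<bar>f\<^sub>2\<bar>)\<close> gives \<open>N(f\<^sub>1, f\<^sub>2)\<^sup>1\<^sup>/\<^sup>2 \<le> 2 \<Sum> 2\<^sup>(\<^sup>j\<^sup>+\<^sup>k\<^sup>)\<^sup>/\<^sup>2 M(E\<^sub>j\<^sub>k)\<close>.

  The condition on \<open>(v\<^sub>1, v\<^sub>2)\<close> makes \<open>w = (v\<^sub>1 v\<^sub>2)\<^sup>1\<^sup>/\<^sup>2\<close> an \<open>A\<^sub>1\<close> weight, so by the Vitali covering lemma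
  \<open>M(E)\<close> has weak \<open>L\<^sup>1(w)\<close> norm at most a constant times \<open>w(E)\<close>, and \<open>w(E)\<^sup>2 \<le> v\<^sub>1(E) v\<^sub>2(E)\<close> by
  Cauchy-Schwarz. Weak \<open>L\<^sup>1\<close> is \<open>r\<close>-normable for \<open>r = 1/q < 1\<close>, and since the \<open>r\<close>-th powers of the bounds
  \<open>2\<^sup>(\<^sup>j\<^sup>+\<^sup>k\<^sup>)\<^sup>/\<^sup>2 v\<^sub>1(E\<^sub>j\<^sub>k)\<^sup>1\<^sup>/\<^sup>2 v\<^sub>2(E\<^sub>j\<^sub>k)\<^sup>1\<^sup>/\<^sup>2\<close> are dominated by products of a function of \<open>j\<close> and a
  function of \<open>k\<close>, their sum factors into the dyadic forms of the two Lorentz norms with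
  \<open>\<alpha> = r/2 = 1/(2q)\<close>.\<close>

section \<open>Sums in weak \<open>L\<^sup>1\<close>\<close>

text \<open>The bracket is open below and closed above, so that its lower end matches strict
  superlevel sets \<open>{x. s < F x}\<close>. This is why the witness is a ceiling minus one rather
  than a floor.\<close>

lemma dyadic_bracket:
  fixes r :: real
  assumes "0 < r"
  obtains j :: int where "2 powr real_of_int j < r" "r \<le> 2 powr (real_of_int j + 1)"
proof
  let ?j = "\<lceil>log 2 r\<rceil> - 1"
  have "2 powr real_of_int ?j < 2 powr (log 2 r)"
    by (intro powr_less_mono) linarith+
  then show "2 powr real_of_int ?j < r" using assms by simp
  have "2 powr (log 2 r) \<le> 2 powr (real_of_int ?j + 1)"
    by (intro powr_mono) linarith+
  then show "r \<le> 2 powr (real_of_int ?j + 1)" using assms by simp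
qed

lemma term_le_suminf_ennreal: "f j \<le> (\<Sum>i. f i)" for f :: "nat \<Rightarrow> ennreal"
  using sum_le_suminf[of f "{j}"] by (simp add: summableI)

text \<open>If \<open>g\<close> exceeds \<open>s * c / 2\<close>, it lies in one shell
  \<open>s * 2 powr (- j - 1) < g \<le> s * 2 powr (- j)\<close>, and the single term
  \<open>j\<close> already dominates it. There \<open>2 powr (- j) \<ge> c / 2\<close>, and since
  \<open>1 - q\<close> is negative the natural weight \<open>2 powr (- j)\<close> can be exchanged
  for \<open>2 powr (- j * q)\<close> at the price \<open>(c/2) powr (1 - q)\<close>. The exchange
  is made because weak type bounds at these levels grow like \<open>2 powr j\<close>, so only the
  smaller weights are summable against them.\<close>

lemma truncated_dyadic_bound:
  fixes q s c :: real and g :: ennreal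
  assumes q: "1 < q" and s: "0 < s" and c: "0 < c" and g: "g \<le> ennreal s"
  shows "g \<le> ennreal (s * c / 2) + ennreal ((c/2) powr (1 - q) * s) *
           (\<Sum>j. ennreal (2 powr (- real j * q)) * indicator {u. ennreal (s * 2 powr (- real j - 1)) < u} g)"
    (is "_ \<le> _ + ?a * suminf ?h")
proof (cases "g \<le> ennreal (s * c / 2)")
  case True
  then show ?thesis by (simp add: add_increasing2)
next
  case False
  define r where "r = enn2real g"
  have gr: "g = ennreal r" "0 \<le> r"
    using g by (auto simp: r_def ennreal_enn2real_if top_unique)
  have r: "s * c / 2 < r" "r \<le> s" "0 < r"
  proof -
    show "s * c / 2 < r" using False s c by (simp add: gr not_le ennreal_less_iff)
    moreover have "0 < s * c / 2" using s c by simp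
    ultimately show "0 < r" by linarith
    show "r \<le> s" using g s gr by simp
  qed
  obtain i :: int where i: "2 powr real_of_int i < r / s" "r / s \<le> 2 powr (real_of_int i + 1)"
    using dyadic_bracket[of "r/s"] r s by auto
  have "2 powr real_of_int i < 1" using i(1) r s by (smt (verit) divide_le_eq_1)
  then have "i < 0"
    by (smt (verit) ge_one_powr_ge_zero of_int_0_le_iff)
  \<comment> \<open>The strict lower end gives \<open>2 powr i < r / s \<le> 1\<close>, hence
    \<open>i \<le> -1\<close>, and the shells are numbered from \<open>j = 0\<close>.\<close>
  define j where "j = nat (- i - 1)"
  have ij: "real_of_int i = - real j - 1" using \<open>i < 0\<close> by (simp add: j_def)
  have lo: "s * 2 powr (- real j - 1) < r" using i(1) s unfolding ij by (simp add: field_simps)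
  have hi: "r / s \<le> 2 powr (- real j)" using i(2) unfolding ij by simp
  have "c / 2 \<le> 2 powr (- real j)" using hi r s by (smt (verit) field_sum_of_halves pos_le_divide_eq mult.commute times_divide_eq_right)
  then have "(2 powr (- real j)) powr (1 - q) \<le> (c/2) powr (1 - q)"
    using q c by (intro powr_mono2') auto
  then have "(2 powr (- real j)) powr (1 - q) * 2 powr (- real j * q) \<le> (c/2) powr (1 - q) * 2 powr (- real j * q)"
    by (intro mult_right_mono) auto
  moreover have "(2 powr (- real j)) powr (1 - q) * 2 powr (- real j * q) = 2 powr (- real j)"
    by (simp add: powr_powr powr_add[symmetric] algebra_simps)
  ultimately have "2 powr (- real j) \<le> (c/2) powr (1 - q) * 2 powr (- real j * q)" by (simp only:)
  with hi have "r / s \<le> (c/2) powr (1 - q) * 2 powr (- real j * q)" by simp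
  then have "r \<le> (c/2) powr (1 - q) * s * 2 powr (- real j * q)"
    using s by (simp add: field_simps)
  then have "g \<le> ?a * ennreal (2 powr (- real j * q))"
    using s by (simp add: gr ennreal_mult[symmetric] ennreal_leI)
  also have "\<dots> = ?a * ?h j"
    using lo s by (simp add: gr ennreal_less_iff)
  also have "\<dots> \<le> ?a * suminf ?h"
    by (intro mult_left_mono term_le_suminf_ennreal) auto
  finally show ?thesis by (simp add: add_increasing)
qed

text \<open>The \<open>1/q\<close>-normability of weak \<open>L\<^sup>1\<close>, normalized. Where some \<open>g k > s\<close> a union bound suffices; elsewhere
  the part of \<open>g k\<close> below \<open>s * c k / 2\<close> contributes at most \<open>s / 2\<close> in total, and Markov's inequality
  applies to the dyadic majorant of the rest.\<close>

lemma weak_type_suminf: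
  fixes g :: "nat \<Rightarrow> 'a \<Rightarrow> ennreal" and c :: "nat \<Rightarrow> real" and q s :: real
  assumes q: "1 < q" and s: "0 < s"
    and meas[measurable]: "\<And>k. g k \<in> borel_measurable M"
    and c: "\<And>k. 0 < c k" and sum_c: "(\<Sum>k. ennreal (c k)) \<le> 1"
    and weak: "\<And>k t. 0 < t \<Longrightarrow> emeasure M {x\<in>space M. ennreal t < g k x} \<le> ennreal (c k powr q / t)"
  shows "emeasure M {x\<in>space M. ennreal s < (\<Sum>k. g k x)}
           \<le> ennreal ((1 + 2 powr (q + 1) / (1 - 2 powr (1 - q))) / s)"
proof -
  \<comment> \<open>The ratio of the geometric series in \<open>j\<close>: the weight
    \<open>2 powr (- j * q)\<close> times a weak type bound of order \<open>2 powr j\<close>. It is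
    below 1 because \<open>q > 1\<close>.\<close>
  let ?\<theta> = "2 powr (1 - q)"
  have \<theta>: "0 < ?\<theta>" "?\<theta> < 1" using q powr_less_mono[of "1 - q" 0 2] by auto
  define a where "a k = (c k / 2) powr (1 - q) * s" for k
  define h where "h k j x = ennreal (2 powr (- real j * q)) *
    indicator {u. ennreal (s * 2 powr (- real j - 1)) < u} (g k x)" for k j x
  define H where "H x = (\<Sum>k. ennreal (a k) * (\<Sum>j. h k j x))" for x
  have h_meas[measurable]: "h k j \<in> borel_measurable M" for k j
    unfolding h_def by measurable
  have H_meas[measurable]: "H \<in> borel_measurable M"
    unfolding H_def by measurable
  have c1: "c k \<le> 1" for k
    using order_trans[OF term_le_suminf_ennreal[of "\<lambda>k. ennreal (c k)" k] sum_c] by simp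
  have "{x\<in>space M. ennreal s < (\<Sum>k. g k x)}
      \<subseteq> (\<Union>k. {x\<in>space M. ennreal s < g k x}) \<union> {x\<in>space M. 1 \<le> ennreal (2/s) * H x}"
  proof safe
    fix x assume x: "x \<in> space M" and gt: "ennreal s < (\<Sum>k. g k x)"
      and n: "x \<notin> (\<Union>k. {x\<in>space M. ennreal s < g k x})"
    have "(\<Sum>k. g k x) \<le> (\<Sum>k. ennreal (s / 2) * ennreal (c k) + ennreal (a k) * (\<Sum>j. h k j x))"
    proof (intro suminf_le summableI)
      fix k
      have "g k x \<le> ennreal s" using n x by (auto simp: not_less)
      from truncated_dyadic_bound[OF q s c[of k] this]
      show "g k x \<le> ennreal (s / 2) * ennreal (c k) + ennreal (a k) * (\<Sum>j. h k j x)"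
        using s c[of k] by (simp add: a_def h_def ennreal_mult[symmetric] less_imp_le)
    qed
    also have "\<dots> = ennreal (s / 2) * (\<Sum>k. ennreal (c k)) + H x"
      unfolding H_def by (subst suminf_add[symmetric]) (auto intro: summableI)
    also have "\<dots> \<le> ennreal (s / 2) * 1 + H x"
      by (intro add_mono mult_left_mono sum_c) auto
    finally have *: "ennreal s < ennreal (s / 2) + H x" using gt by simp
    \<comment> \<open>The small parts of the \<open>g k\<close> use up at most \<open>s / 2\<close>,
      so \<open>H x\<close> exceeds \<open>s / 2\<close>; the inequality is scaled to the form in
      which Markov's inequality is applied.\<close>
    show "1 \<le> ennreal (2/s) * H x"
    proof (cases "H x")
      case (real y)
      then have "s < s / 2 + y" using * s by (simp add: ennreal_plus[symmetric] ennreal_less_iff del: ennreal_plus)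
      then have "1 \<le> 2 / s * y" using s by (simp add: field_simps)
      then show ?thesis using real s by (simp add: ennreal_mult[symmetric])
    qed (use s in \<open>simp add: ennreal_mult_top\<close>)
  qed
  then have "emeasure M {x\<in>space M. ennreal s < (\<Sum>k. g k x)}
      \<le> emeasure M ((\<Union>k. {x\<in>space M. ennreal s < g k x}) \<union> {x\<in>space M. 1 \<le> ennreal (2/s) * H x})"
    by (intro emeasure_mono) auto
  also have "\<dots> \<le> emeasure M (\<Union>k. {x\<in>space M. ennreal s < g k x}) + emeasure M {x\<in>space M. 1 \<le> ennreal (2/s) * H x}"
    by (intro emeasure_subadditive) auto
  also have "\<dots> \<le> ennreal (1 / s) + ennreal (2 powr (q + 1) / (1 - ?\<theta>) / s)"
  proof (intro add_mono)
    have "emeasure M (\<Union>k. {x\<in>space M. ennreal s < g k x}) \<le> (\<Sum>k. emeasure M {x\<in>space M. ennreal s < g k x})"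
      by (intro emeasure_subadditive_countably) auto
    also have "\<dots> \<le> (\<Sum>k. ennreal (1/s) * ennreal (c k))"
    proof (intro suminf_le summableI)
      fix k
      \<comment> \<open>Since \<open>c k \<le> 1\<close>, the weak type bound at level
        \<open>s\<close> is at most \<open>c k / s\<close>, which sums to at most
        \<open>1 / s\<close>.\<close>
      have "c k powr q \<le> c k powr 1" using c[of k] c1[of k] q by (intro powr_mono') auto
      then have "c k powr q / s \<le> 1 / s * c k" using c[of k] s by (simp add: field_simps)
      then show "emeasure M {x\<in>space M. ennreal s < g k x} \<le> ennreal (1/s) * ennreal (c k)"
        using weak[OF s, of k] c[of k] s by (simp add: ennreal_mult[symmetric] less_imp_le) (meson ennreal_leI order_trans)
    qed
    also have "\<dots> \<le> ennreal (1/s) * 1"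
      unfolding ennreal_suminf_cmult by (intro mult_left_mono sum_c) auto
    finally show "emeasure M (\<Union>k. {x\<in>space M. ennreal s < g k x}) \<le> ennreal (1 / s)" by simp
  next
    have hint: "(\<integral>\<^sup>+x. h k j x \<partial>M) \<le> ennreal (2 powr (- real j * q) * (c k powr q / (s * 2 powr (- real j - 1))))" for k j
    proof -
      have "(\<integral>\<^sup>+x. h k j x \<partial>M) = (\<integral>\<^sup>+x. ennreal (2 powr (- real j * q)) *
           indicator {x\<in>space M. ennreal (s * 2 powr (- real j - 1)) < g k x} x \<partial>M)"
        by (intro nn_integral_cong) (auto simp: h_def indicator_def)
      also have "\<dots> = ennreal (2 powr (- real j * q)) * emeasure M {x\<in>space M. ennreal (s * 2 powr (- real j - 1)) < g k x}"
        by (subst nn_integral_cmult_indicator) auto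
      also have "\<dots> \<le> ennreal (2 powr (- real j * q)) * ennreal (c k powr q / (s * 2 powr (- real j - 1)))"
        using s by (intro mult_left_mono weak) auto
      finally show ?thesis by (subst ennreal_mult') auto
    qed
    have sums: "(\<lambda>j. ?\<theta> ^ j) sums (1 / (1 - ?\<theta>))" using \<theta> by (intro geometric_sums) auto
    have "(\<integral>\<^sup>+x. H x \<partial>M) = (\<Sum>k. ennreal (a k) * (\<Sum>j. \<integral>\<^sup>+x. h k j x \<partial>M))"
      unfolding H_def by (simp add: nn_integral_suminf nn_integral_cmult)
    also have "\<dots> \<le> (\<Sum>k. ennreal (2 powr q / (1 - ?\<theta>)) * ennreal (c k))"
    proof (intro suminf_le summableI)
      fix k
      \<comment> \<open>The powers \<open>1 - q\<close> and \<open>q\<close> of \<open>c k\<close>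
        combine to the first power and \<open>s\<close> cancels, so that the hypothesis on the sum
        of the \<open>c k\<close> finishes the estimate.\<close>
      have eq: "a k * (2 powr (- real j * q) * (c k powr q / (s * 2 powr (- real j - 1)))) = 2 powr q * c k * ?\<theta> ^ j" for j
      proof -
        have "(c k / 2) powr (1 - q) * c k powr q = c k * 2 powr (q - 1)"
          using c[of k] by (simp add: powr_divide powr_diff field_simps)
        moreover have "2 powr (- real j * q) / 2 powr (- real j - 1) = 2 * ?\<theta> ^ j"
        proof -
          have "?\<theta> ^ j = 2 powr ((1 - q) * real j)" by (simp add: powr_powr[symmetric] powr_realpow)
          then have "2 * ?\<theta> ^ j = 2 powr (1 + (1 - q) * real j)" by (simp add: powr_add)
          then show ?thesis by (simp add: powr_diff[symmetric] algebra_simps)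
        qed
        ultimately have "((c k / 2) powr (1 - q) * c k powr q) * (2 powr (- real j * q) / 2 powr (- real j - 1)) = (c k * 2 powr (q - 1)) * (2 * ?\<theta> ^ j)"
          by simp
        moreover have "2 powr (q - 1) * 2 = (2::real) powr q" by (simp add: powr_diff)
        ultimately show ?thesis using s unfolding a_def by (simp add: field_simps)
      qed
      have eq': "ennreal (a k) * ennreal (2 powr (- real j * q) * (c k powr q / (s * 2 powr (- real j - 1))))
          = ennreal (2 powr q * c k * ?\<theta> ^ j)" for j
        unfolding eq[symmetric] using s by (intro ennreal_mult'[symmetric]) (simp add: a_def)
      have "ennreal (a k) * (\<Sum>j. \<integral>\<^sup>+x. h k j x \<partial>M)
         \<le> ennreal (a k) * (\<Sum>j. ennreal (2 powr (- real j * q) * (c k powr q / (s * 2 powr (- real j - 1)))))"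
        by (intro mult_left_mono suminf_le summableI hint) auto
      also have "\<dots> = (\<Sum>j. ennreal (2 powr q * c k * ?\<theta> ^ j))"
        by (simp only: ennreal_suminf_cmult[symmetric] eq')
      also have "\<dots> = ennreal (2 powr q * c k * (1 / (1 - ?\<theta>)))"
        using c[of k] by (intro suminf_ennreal_eq sums_mult[OF sums]) (auto simp: less_imp_le)
      finally show "ennreal (a k) * (\<Sum>j. \<integral>\<^sup>+x. h k j x \<partial>M) \<le> ennreal (2 powr q / (1 - ?\<theta>)) * ennreal (c k)"
        using c[of k] \<theta> by (simp add: ennreal_mult[symmetric] less_imp_le)
    qed
    also have "\<dots> \<le> ennreal (2 powr q / (1 - ?\<theta>)) * 1"
      unfolding ennreal_suminf_cmult by (intro mult_left_mono sum_c) auto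
    finally have I: "(\<integral>\<^sup>+x. H x \<partial>M) \<le> ennreal (2 powr q / (1 - ?\<theta>))" by simp
    have "emeasure M {x\<in>space M. 1 \<le> ennreal (2/s) * H x} \<le> ennreal (2/s) * (\<integral>\<^sup>+x. H x * indicator (space M) x \<partial>M)"
      by (intro nn_integral_Markov_inequality) auto
    also have "(\<integral>\<^sup>+x. H x * indicator (space M) x \<partial>M) = (\<integral>\<^sup>+x. H x \<partial>M)"
      by (intro nn_integral_cong) auto
    also have "ennreal (2/s) * (\<integral>\<^sup>+x. H x \<partial>M) \<le> ennreal (2/s) * ennreal (2 powr q / (1 - ?\<theta>))"
      by (intro mult_left_mono I) auto
    also have "\<dots> = ennreal (2 powr (q + 1) / (1 - ?\<theta>) / s)"
      using s \<theta> by (simp add: ennreal_mult[symmetric] powr_add field_simps)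
    finally show "emeasure M {x\<in>space M. 1 \<le> ennreal (2/s) * H x} \<le> ennreal (2 powr (q + 1) / (1 - ?\<theta>) / s)" .
  qed
  also have "\<dots> = ennreal ((1 + 2 powr (q + 1) / (1 - ?\<theta>)) / s)"
    using s \<theta> by (subst ennreal_plus[symmetric]) (auto simp: add_divide_distrib)
  finally show ?thesis .
qed

section \<open>The maximal function of a set\<close>

text \<open>The centred Hardy-Littlewood maximal function of the indicator of \<open>E\<close>, up
  to the volume of the unit ball.\<close>

definition ball_max :: "'a::euclidean_space set \<Rightarrow> 'a \<Rightarrow> ennreal" where
  "ball_max E x = (SUP \<rho>\<in>{0<..}. emeasure lebesgue (E \<inter> ball x \<rho>) / ennreal (\<rho> ^ DIM('a)))"

lemma less_ball_max_iff:
  fixes E :: "'a::euclidean_space set"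
  assumes "0 \<le> t"
  shows "ennreal t < ball_max E x \<longleftrightarrow>
    (\<exists>\<rho>>0. ennreal (t * \<rho> ^ DIM('a)) < emeasure lebesgue (E \<inter> ball x \<rho>))"
proof -
  have "ennreal t < a / ennreal b \<longleftrightarrow> ennreal (t * b) < a" if "0 < b" for a and b :: real
  proof (cases a)
    case (real r)
    then show ?thesis using that assms
      by (simp add: divide_ennreal ennreal_less_iff pos_less_divide_eq)
  next
    case top
    then show ?thesis using that by (simp add: ennreal_top_divide)
  qed
  then show ?thesis by (auto simp: ball_max_def less_SUP_iff)
qed

text \<open>A strict inequality at radius \<open>\<rho>\<close> persists for a slightly larger
  radius \<open>r\<close>, and \<open>ball y r\<close> contains \<open>ball x \<rho>\<close> once
  \<open>y\<close> is within \<open>r - \<rho>\<close> of \<open>x\<close>. The cap \<open>R\<close>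
  on the radii is there for the Vitali lemma, which asks for bounded radii.\<close>

lemma open_ball_max_truncated:
  fixes E :: "'a::euclidean_space set"
  assumes E: "E \<in> sets lebesgue" and t: "0 \<le> t"
  shows "open {x. \<exists>\<rho>. 0 < \<rho> \<and> \<rho> < R \<and> ennreal (t * \<rho> ^ DIM('a)) < emeasure lebesgue (E \<inter> ball x \<rho>)}"
proof (rule openI)
  fix x assume "x \<in> {x. \<exists>\<rho>. 0 < \<rho> \<and> \<rho> < R \<and> ennreal (t * \<rho> ^ DIM('a)) < emeasure lebesgue (E \<inter> ball x \<rho>)}"
  then obtain \<rho> where \<rho>: "0 < \<rho>" "\<rho> < R" "ennreal (t * \<rho> ^ DIM('a)) < emeasure lebesgue (E \<inter> ball x \<rho>)" by auto
  have "((\<lambda>r. ennreal (t * r ^ DIM('a))) \<longlongrightarrow> ennreal (t * \<rho> ^ DIM('a))) (at_right \<rho>)"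
    by (intro tendsto_intros)
  then have "\<forall>\<^sub>F r in at_right \<rho>. ennreal (t * r ^ DIM('a)) < emeasure lebesgue (E \<inter> ball x \<rho>)"
    using \<rho>(3) by (rule order_tendstoD(2))
  moreover have "\<forall>\<^sub>F r in at_right \<rho>. r \<in> {\<rho><..<R}"
    using \<rho>(2) by (rule eventually_at_right_real)
  ultimately have "\<forall>\<^sub>F r in at_right \<rho>. ennreal (t * r ^ DIM('a)) < emeasure lebesgue (E \<inter> ball x \<rho>) \<and> r \<in> {\<rho><..<R}"
    by (rule eventually_conj)
  from eventually_happens'[OF trivial_limit_at_right_real this]
  obtain r where r: "ennreal (t * r ^ DIM('a)) < emeasure lebesgue (E \<inter> ball x \<rho>) \<and> r \<in> {\<rho><..<R}"
    by (rule exE)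
  show "\<exists>e>0. ball x e \<subseteq> {x. \<exists>\<rho>. 0 < \<rho> \<and> \<rho> < R \<and> ennreal (t * \<rho> ^ DIM('a)) < emeasure lebesgue (E \<inter> ball x \<rho>)}"
  proof (rule exI[of _ "r - \<rho>"], intro conjI subsetI CollectI exI[of _ r])
    fix y assume "y \<in> ball x (r - \<rho>)"
    then have "ball x \<rho> \<subseteq> ball y r"
    proof (intro subsetI)
      fix z assume "z \<in> ball x \<rho>"
      then show "z \<in> ball y r"
        using dist_triangle[of y z x] \<open>y \<in> ball x (r - \<rho>)\<close> by (simp add: dist_commute)
    qed
    then have "emeasure lebesgue (E \<inter> ball x \<rho>) \<le> emeasure lebesgue (E \<inter> ball y r)"
      using E by (intro emeasure_mono) auto
    then show "ennreal (t * r ^ DIM('a)) < emeasure lebesgue (E \<inter> ball y r)"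
      using r by (metis order_less_le_trans)
  qed (use \<rho> r in auto)
qed

lemma ball_max_measurable:
  fixes E :: "'a::euclidean_space set"
  assumes E: "E \<in> sets lebesgue"
  shows "ball_max E \<in> borel_measurable borel"
proof (rule borel_measurableI_greater)
  fix y :: ennreal
  show "{x \<in> space borel. y < ball_max E x} \<in> sets borel"
  proof (cases y)
    case (real t)
    have "{x. y < ball_max E x} = (\<Union>R::nat. {x. \<exists>\<rho>. 0 < \<rho> \<and> \<rho> < real R \<and> ennreal (t * \<rho> ^ DIM('a)) < emeasure lebesgue (E \<inter> ball x \<rho>)})"
      using real by (auto simp: less_ball_max_iff) (metis reals_Archimedean2)
    then have "open {x. y < ball_max E x}"
      by (simp only:) (intro open_UN ballI open_ball_max_truncated E real(1))
    then show ?thesis by simp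
  qed simp
qed

section \<open>Weak type of the maximal function by Vitali covering\<close>

lemma emeasure_cube:
  assumes "0 \<le> l"
  shows "emeasure lebesgue (cbox a (a + vec l :: real^'n)) = ennreal (l ^ CARD('n))"
proof -
  have "emeasure lebesgue (cbox a (a + vec l)) = ennreal (\<Prod>b\<in>(Basis :: (real^'n) set). vec l \<bullet> b)"
    using assms by (simp add: emeasure_lborel_cbox_eq)
      (auto simp: Basis_vec_def inner_axis inner_add_left)
  also have "(\<Prod>b\<in>(Basis :: (real^'n) set). vec l \<bullet> b) = (\<Prod>b\<in>(Basis :: (real^'n) set). l)"
    by (intro prod.cong) (auto simp: Basis_vec_def inner_axis)
  finally show ?thesis by simp
qed

text \<open>The Vitali lemma yields a countable set of centres rather than a sequence. The sum is an
  integral over \<open>count_space I\<close> so that it meets \<open>emeasure_UN_countable\<close>,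
  which handles the disjoint balls.\<close>

lemma emeasure_UN_countable_subadditive:
  assumes X: "\<And>i. i \<in> I \<Longrightarrow> X i \<in> sets M" and I: "countable I"
  shows "emeasure M (\<Union>i\<in>I. X i) \<le> (\<integral>\<^sup>+i. emeasure M (X i) \<partial>count_space I)"
proof -
  define Z where "Z n = (if n \<in> to_nat_on I ` I then X (from_nat_into I n) else {})" for n
  have "(\<Union>i\<in>I. X i) = (\<Union>n. Z n)"
    using I by (fastforce simp: Z_def split: if_splits)
  also have "emeasure M \<dots> \<le> (\<Sum>n. emeasure M (Z n))"
    using I X by (intro emeasure_subadditive_countably) (auto simp: Z_def)
  also have "\<dots> = (\<integral>\<^sup>+n. emeasure M (X (from_nat_into I n)) * indicator (to_nat_on I ` I) n \<partial>count_space UNIV)"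
    unfolding nn_integral_count_space_nat by (intro suminf_cong) (auto simp: Z_def)
  also have "\<dots> = (\<integral>\<^sup>+n. emeasure M (X (from_nat_into I n)) \<partial>count_space (to_nat_on I ` I))"
    by (simp add: nn_integral_count_space_indicator)
  also have "\<dots> = (\<integral>\<^sup>+i. emeasure M (X (from_nat_into I (to_nat_on I i))) \<partial>count_space I)"
    using I by (intro nn_integral_bij_count_space[symmetric] inj_on_imp_bij_betw inj_on_to_nat_on)
  also have "\<dots> = (\<integral>\<^sup>+i. emeasure M (X i) \<partial>count_space I)"
    using I by (intro nn_integral_cong) auto
  finally show ?thesis .
qed

text \<open>The constant of the weak type inequality: a cube containing the fivefold dilate of a ball of
  radius \<open>\<rho>\<close> may be taken of side \<open>10\<rho>\<close>.\<close>

lemma ball_max_weak_type: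
  fixes E :: "(real^'n) set" and K :: real
  assumes sets: "sets W = sets lebesgue"
    and K: "\<And>Q F. Q \<in> cubes \<Longrightarrow> F \<in> sets lebesgue \<Longrightarrow> F \<subseteq> Q \<Longrightarrow>
      emeasure W Q * emeasure lebesgue F \<le> ennreal K * emeasure lebesgue Q * emeasure W F"
    and "0 \<le> K" and E: "E \<in> sets lebesgue" and t: "0 < t"
  shows "emeasure W {x. ennreal t < ball_max E x} \<le> ennreal (K * 10 ^ CARD('n) / t) * emeasure W E"
proof -
  let ?n = "CARD('n)"
  define A where "A R = {x::real^'n. \<exists>\<rho>. 0 < \<rho> \<and> \<rho> < R \<and> ennreal (t * \<rho> ^ ?n) < emeasure lebesgue (E \<inter> ball x \<rho>)}" for R
  have A_open: "open (A R)" for R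
    using open_ball_max_truncated[OF E, of t R] t by (simp add: A_def)
  have A_sets: "A R \<in> sets W" for R
    using A_open by (simp add: sets)
  \<comment> \<open>The hypothesis \<open>K\<close> for \<open>F = E \<inter> ball x \<rho>\<close>:
    as \<open>F\<close> has Lebesgue measure above \<open>t * \<rho> ^ ?n\<close>, the
    \<open>W\<close>-measure of the dilated ball is paid for by a piece of \<open>E\<close> inside
    the original ball.\<close>
  have single: "emeasure W (cball x (5 * \<rho>)) \<le> ennreal (K * 10 ^ ?n / t) * emeasure W (E \<inter> ball x \<rho>)"
    if \<rho>: "0 < \<rho>" "ennreal (t * \<rho> ^ ?n) < emeasure lebesgue (E \<inter> ball x \<rho>)" for x :: "real^'n" and \<rho>
  proof -
    define Q where "Q = cbox (x - vec (5 * \<rho>)) (x - vec (5 * \<rho>) + vec (10 * \<rho>) :: real^'n)"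
    have Q: "Q \<in> cubes" unfolding cubes_def Q_def
      by (intro CollectI exI[of _ "x - vec (5 * \<rho>)"] exI[of _ "10 * \<rho>"] conjI refl) (use \<rho> in auto)
    have sub: "cball x (5 * \<rho>) \<subseteq> Q"
    proof
      fix y assume "y \<in> cball x (5 * \<rho>)"
      then have "\<bar>(y - x) $ i\<bar> \<le> 5 * \<rho>" for i
        using component_le_norm_cart[of "y - x" i] by (simp add: dist_norm norm_minus_commute)
      then show "y \<in> Q" by (auto simp: Q_def mem_box_cart abs_le_iff algebra_simps)
    qed
    have EQ: "E \<inter> ball x \<rho> \<subseteq> Q" using sub \<rho> by (auto simp: subset_iff)
    have Qmeas: "emeasure lebesgue Q = ennreal ((10 * \<rho>) ^ ?n)"
      unfolding Q_def using \<rho> by (intro emeasure_cube) auto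
    have "emeasure W (cball x (5 * \<rho>)) * ennreal (t * \<rho> ^ ?n) \<le> emeasure W Q * emeasure lebesgue (E \<inter> ball x \<rho>)"
      using \<rho> sub by (intro mult_mono emeasure_mono) (auto simp: sets Q_def)
    also have "\<dots> \<le> ennreal K * emeasure lebesgue Q * emeasure W (E \<inter> ball x \<rho>)"
      using E by (intro K Q EQ) auto
    finally have *: "emeasure W (cball x (5 * \<rho>)) * ennreal (t * \<rho> ^ ?n) \<le> ennreal (K * (10 * \<rho>) ^ ?n) * emeasure W (E \<inter> ball x \<rho>)"
      using \<open>0 \<le> K\<close> \<rho> by (simp add: Qmeas ennreal_mult)
    have "emeasure W (cball x (5 * \<rho>)) = ennreal (1 / (t * \<rho> ^ ?n)) * (emeasure W (cball x (5 * \<rho>)) * ennreal (t * \<rho> ^ ?n))"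
    proof -
      have "ennreal (1 / (t * \<rho> ^ ?n)) * ennreal (t * \<rho> ^ ?n) = 1"
        using t \<rho> by (simp add: ennreal_mult'[symmetric])
      then show ?thesis by (simp add: mult.left_commute[of "ennreal (1 / (t * \<rho> ^ ?n))"])
    qed
    also have "\<dots> \<le> ennreal (1 / (t * \<rho> ^ ?n)) * (ennreal (K * (10 * \<rho>) ^ ?n) * emeasure W (E \<inter> ball x \<rho>))"
      by (intro mult_left_mono *) auto
    also have "\<dots> = ennreal (K * 10 ^ ?n / t) * emeasure W (E \<inter> ball x \<rho>)"
      unfolding mult.assoc[symmetric] using t \<rho> \<open>0 \<le> K\<close>
      by (subst ennreal_mult[symmetric]) (auto simp: power_mult_distrib)
    finally show ?thesis .
  qed
  have A_bound: "emeasure W (A R) \<le> ennreal (K * 10 ^ ?n / t) * emeasure W E" for R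
  proof -
    have "\<forall>x\<in>A R. \<exists>\<rho>. 0 < \<rho> \<and> \<rho> < R \<and> ennreal (t * \<rho> ^ ?n) < emeasure lebesgue (E \<inter> ball x \<rho>)"
      by (simp add: A_def)
    then obtain \<rho> where \<rho>: "\<And>x. x \<in> A R \<Longrightarrow> 0 < \<rho> x \<and> \<rho> x < R \<and> ennreal (t * \<rho> x ^ ?n) < emeasure lebesgue (E \<inter> ball x (\<rho> x))"
      by (metis (no_types, lifting))
    have cover: "A R \<subseteq> (\<Union>x\<in>A R. cball x (\<rho> x))"
      using \<rho> by (force intro: less_imp_le)
    \<comment> \<open>The dilated balls cover \<open>A R\<close>, while the original ones are
      disjoint, so the pieces \<open>E \<inter> ball x (\<rho> x)\<close> have total
      \<open>W\<close>-measure at most that of \<open>E\<close>.\<close>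
    obtain D where D: "countable D" "D \<subseteq> A R"
        "pairwise (\<lambda>x y. disjnt (cball x (\<rho> x)) (cball y (\<rho> y))) D"
        "A R \<subseteq> (\<Union>x\<in>D. cball x (5 * \<rho> x))"
      by (rule Vitali_covering_lemma_cballs[OF cover]) (use \<rho> in \<open>auto intro: less_imp_le\<close>)
    have "emeasure W (A R) \<le> emeasure W (\<Union>x\<in>D. cball x (5 * \<rho> x))"
      using D by (intro emeasure_mono) (auto simp: sets intro!: sets.countable_UN')
    also have "\<dots> \<le> (\<integral>\<^sup>+x. emeasure W (cball x (5 * \<rho> x)) \<partial>count_space D)"
      using D by (intro emeasure_UN_countable_subadditive) (auto simp: sets)
    also have "\<dots> \<le> (\<integral>\<^sup>+x. ennreal (K * 10 ^ ?n / t) * emeasure W (E \<inter> ball x (\<rho> x)) \<partial>count_space D)"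
      using \<rho> D(2) by (intro nn_integral_mono single) auto
    also have "\<dots> = ennreal (K * 10 ^ ?n / t) * (\<integral>\<^sup>+x. emeasure W (E \<inter> ball x (\<rho> x)) \<partial>count_space D)"
      by (intro nn_integral_cmult) auto
    also have "(\<integral>\<^sup>+x. emeasure W (E \<inter> ball x (\<rho> x)) \<partial>count_space D) = emeasure W (\<Union>x\<in>D. E \<inter> ball x (\<rho> x))"
    proof (intro emeasure_UN_countable[symmetric])
      show "disjoint_family_on (\<lambda>x. E \<inter> ball x (\<rho> x)) D"
        using D(3) unfolding disjoint_family_on_def pairwise_def disjnt_def
        by (auto simp: set_eq_iff) (metis less_imp_le)
    qed (use D E in \<open>auto simp: sets\<close>)
    also have "\<dots> \<le> emeasure W E"
      using E by (intro emeasure_mono) (auto simp: sets)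
    finally show ?thesis by (simp add: mult_left_mono)
  qed
  \<comment> \<open>The bound does not depend on \<open>R\<close>, so continuity from below removes
    the cap on the radii.\<close>
  have "{x. ennreal t < ball_max E x} = (\<Union>R::nat. A (real R))"
    using t by (auto simp: less_ball_max_iff A_def) (metis reals_Archimedean2)
  moreover have "(SUP R::nat. emeasure W (A (real R))) = emeasure W (\<Union>R::nat. A (real R))"
  proof (intro SUP_emeasure_incseq)
    show "incseq (\<lambda>R::nat. A (real R))"
      unfolding incseq_def A_def by (intro allI impI Collect_mono) fastforce
  qed (use A_sets in auto)
  ultimately show ?thesis
    by (metis (mono_tags, lifting) A_bound SUP_least)
qed

section \<open>The weights\<close>

lemma sets_weight_measure[simp]: "sets (weight_measure w) = sets lebesgue"
  by (simp add: weight_measure_def)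

lemma space_weight_measure[simp]: "space (weight_measure w) = UNIV"
  by (simp add: weight_measure_def)

lemma emeasure_weight_measure:
  assumes "w \<in> borel_measurable lebesgue" "A \<in> sets lebesgue"
  shows "emeasure (weight_measure w) A = (\<integral>\<^sup>+x. ennreal (w x) * indicator A x \<partial>lebesgue)"
  using assms unfolding weight_measure_def by (intro emeasure_density) auto

lemma geom_weight_measurable:
  assumes "is_weight v1" "is_weight v2"
  shows "geom_weight v1 v2 \<in> borel_measurable lebesgue"
proof -
  have [measurable]: "v1 \<in> borel_measurable lebesgue" "v2 \<in> borel_measurable lebesgue"
    using assms by (auto simp: is_weight_def)
  show ?thesis unfolding geom_weight_def[abs_def] by measurable
qed

text \<open>The pair condition bounds the square of the mean of \<open>geom_weight v1 v2\<close> on a cube by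
  \<open>v1 x * v2 x\<close> at almost every point, which makes \<open>geom_weight v1 v2\<close> an \<open>A\<^sub>1\<close> weight.\<close>

lemma A_half_imp_A1:
  fixes v1 v2 :: "real^'n \<Rightarrow> real"
  assumes "A_half v1 v2"
  obtains K :: real where "0 \<le> K"
    "\<And>Q F. Q \<in> cubes \<Longrightarrow> F \<in> sets lebesgue \<Longrightarrow> F \<subseteq> Q \<Longrightarrow>
      emeasure (weight_measure (geom_weight v1 v2)) Q * emeasure lebesgue F
        \<le> ennreal K * emeasure lebesgue Q * emeasure (weight_measure (geom_weight v1 v2)) F"
proof -
  let ?w = "geom_weight v1 v2"
  let ?W = "weight_measure ?w"
  have v: "is_weight v1" "is_weight v2" using assms by (auto simp: A_half_def)
  note [measurable] = geom_weight_measurable[OF v]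
  define S where "S = (SUP Q\<in>cubes.
        ((\<integral>\<^sup>+x\<in>Q. ennreal (geom_weight v1 v2 x) \<partial>lebesgue) / emeasure lebesgue Q)\<^sup>2
        * esssup (lebesgue_on Q) (\<lambda>x. inverse (ennreal (v1 x)))
        * esssup (lebesgue_on Q) (\<lambda>x. inverse (ennreal (v2 x))))"
  have "S < \<infinity>" using assms by (auto simp: A_half_def S_def)
  then obtain K0 where K0: "0 \<le> K0" "S = ennreal K0" by (cases S) auto
  have "emeasure ?W Q * emeasure lebesgue F \<le> ennreal (sqrt K0) * emeasure lebesgue Q * emeasure ?W F"
    if Q: "Q \<in> cubes" and F[measurable]: "F \<in> sets lebesgue" and "F \<subseteq> Q" for Q F
  proof -
    have Qs[measurable]: "Q \<in> sets lebesgue" using Q by (auto simp: cubes_def)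
    obtain a l where al: "0 < l" "Q = cbox a (a + vec l)" using Q by (auto simp: cubes_def)
    define m where "m = l ^ CARD('n)"
    have m: "emeasure lebesgue Q = ennreal m" "0 < m"
      unfolding m_def al(2) using al(1) by (auto intro!: emeasure_cube simp del: emeasure_completion)
    have WQ: "(\<integral>\<^sup>+x\<in>Q. ennreal (?w x) \<partial>lebesgue) = emeasure ?W Q"
      by (simp add: emeasure_weight_measure)
    have ae: "AE x in lebesgue. x \<in> Q \<longrightarrow> P x" if "AE x in lebesgue_on Q. P x" for P
      using that by (simp add: AE_restrict_space_iff)
    have "AE x in lebesgue. x \<in> Q \<longrightarrow> inverse (ennreal (v1 x)) \<le> esssup (lebesgue_on Q) (\<lambda>x. inverse (ennreal (v1 x)))"
      "AE x in lebesgue. x \<in> Q \<longrightarrow> inverse (ennreal (v2 x)) \<le> esssup (lebesgue_on Q) (\<lambda>x. inverse (ennreal (v2 x)))"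
      by (intro ae esssup_AE)+
    moreover have "AE x in lebesgue. 0 < v1 x" "AE x in lebesgue. 0 < v2 x"
      using v by (auto simp: is_weight_def)
    ultimately have pt: "AE x in lebesgue. x \<in> Q \<longrightarrow> emeasure ?W Q \<le> ennreal (sqrt K0 * m) * ennreal (?w x)"
    proof eventually_elim
      case (elim x)
      show ?case
      proof
        assume x: "x \<in> Q"
        have "(emeasure ?W Q / ennreal m)\<^sup>2 * inverse (ennreal (v1 x)) * inverse (ennreal (v2 x))
          \<le> (emeasure ?W Q / ennreal m)\<^sup>2 * esssup (lebesgue_on Q) (\<lambda>x. inverse (ennreal (v1 x)))
              * esssup (lebesgue_on Q) (\<lambda>x. inverse (ennreal (v2 x)))"
          using elim x by (intro mult_mono) auto
        also have "\<dots> \<le> S"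
          unfolding S_def m(1)[symmetric] WQ[symmetric] using Q by (rule SUP_upper)
        finally have le: "(emeasure ?W Q / ennreal m)\<^sup>2 * ennreal (inverse (v1 x) * inverse (v2 x)) \<le> ennreal K0"
          using elim K0 by (simp add: inverse_ennreal ennreal_mult mult.assoc)
        have pos: "0 < inverse (v1 x) * inverse (v2 x)" using elim by simp
        show "emeasure ?W Q \<le> ennreal (sqrt K0 * m) * ennreal (?w x)"
        proof (cases "emeasure ?W Q")
          case (real u)
          then have "(u / m)\<^sup>2 * (inverse (v1 x) * inverse (v2 x)) \<le> K0"
            using le pos m(2) K0
            by (simp add: divide_ennreal ennreal_power ennreal_mult[symmetric])
          then have "(u / m)\<^sup>2 \<le> K0 * (v1 x * v2 x)"
            using pos_divide_le_eq[of "v1 x * v2 x" "(u / m)\<^sup>2" K0] elim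
            by (simp add: divide_inverse)
          then have "sqrt ((u / m)\<^sup>2) \<le> sqrt (K0 * (v1 x * v2 x))" by (rule real_sqrt_le_mono)
          then have "u / m \<le> sqrt K0 * ?w x"
            using real m(2) elim by (simp add: real_sqrt_mult geom_weight_def powr_half_sqrt)
          then have "u \<le> sqrt K0 * m * ?w x" using m(2) by (simp add: field_simps)
          then show ?thesis using real K0 m
            by (simp add: ennreal_mult'[symmetric] ennreal_leI)
        next
          \<comment> \<open>Contradictory: the inverse weights at \<open>x\<close> are positive, so
            an infinite \<open>emeasure ?W Q\<close> would make the left side of \<open>le\<close>
            infinite.\<close>
          case top
          then show ?thesis using le elim by (simp add: ennreal_top_divide ennreal_top_mult top_unique power2_eq_square)
        qed
      qed
    qed
    \<comment> \<open>Integrating the pointwise bound over \<open>F\<close> turns it into the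
      comparison of measures that the covering argument uses.\<close>
    have "emeasure ?W Q * emeasure lebesgue F = (\<integral>\<^sup>+x. emeasure ?W Q * indicator F x \<partial>lebesgue)"
      by (simp add: nn_integral_cmult_indicator)
    also have "\<dots> \<le> (\<integral>\<^sup>+x. ennreal (sqrt K0 * m) * (ennreal (?w x) * indicator F x) \<partial>lebesgue)"
      using pt by (intro nn_integral_mono_AE) (use \<open>F \<subseteq> Q\<close> in \<open>auto elim!: eventually_mono simp: indicator_def\<close>)
    also have "\<dots> = ennreal (sqrt K0 * m) * emeasure ?W F"
      by (simp add: nn_integral_cmult emeasure_weight_measure)
    finally show ?thesis using m K0 by (simp add: ennreal_mult)
  qed
  then show thesis using K0 by (intro that[of "sqrt K0"]) auto
qed

text \<open>Cauchy-Schwarz for the square roots of the weights on \<open>E\<close>. The squared form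
  avoids taking roots of measures that may be infinite.\<close>

lemma geom_weight_measure_le:
  fixes v1 v2 :: "real^'n \<Rightarrow> real"
  assumes v: "is_weight v1" "is_weight v2" and E[measurable]: "E \<in> sets lebesgue"
  shows "(emeasure (weight_measure (geom_weight v1 v2)) E)\<^sup>2
    \<le> emeasure (weight_measure v1) E * emeasure (weight_measure v2) E"
proof -
  note [measurable] = geom_weight_measurable[OF v]
  have [measurable]: "v1 \<in> borel_measurable lebesgue" "v2 \<in> borel_measurable lebesgue"
    using v by (auto simp: is_weight_def)
  let ?r = "\<lambda>v x. ennreal (v x powr (1/2)) * indicator E x"
  have sq: "(\<integral>\<^sup>+x. (?r v x)\<^sup>2 \<partial>lebesgue) = emeasure (weight_measure v) E"
    if "is_weight v" for v
  proof -
    from that have "v \<in> borel_measurable lebesgue" "AE x in lebesgue. 0 < v x"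
      by (auto simp: is_weight_def)
    then show ?thesis
      by (subst emeasure_weight_measure)
        (auto intro!: nn_integral_cong_AE elim!: eventually_mono
          simp: indicator_def ennreal_power powr_half_sqrt)
  qed
  have "emeasure (weight_measure (geom_weight v1 v2)) E = (\<integral>\<^sup>+x. ?r v1 x * ?r v2 x \<partial>lebesgue)"
    by (auto simp: emeasure_weight_measure geom_weight_def ennreal_mult indicator_def intro!: nn_integral_cong)
  also have "\<dots>\<^sup>2 \<le> (\<integral>\<^sup>+x. (?r v1 x)\<^sup>2 \<partial>lebesgue) * (\<integral>\<^sup>+x. (?r v2 x)\<^sup>2 \<partial>lebesgue)"
    by (intro Cauchy_Schwarz_nn_integral) auto
  finally show ?thesis by (simp only: sq v)
qed

section \<open>The operator \<open>N\<close> and Lorentz norms\<close>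

lemma emeasure_le_ball_max:
  fixes E :: "'a::euclidean_space set"
  assumes "0 < \<rho>"
  shows "emeasure lebesgue (E \<inter> ball x \<rho>) \<le> ennreal (\<rho> ^ DIM('a)) * ball_max E x"
proof -
  have *: "emeasure lebesgue (E \<inter> ball x \<rho>) / ennreal (\<rho> ^ DIM('a)) \<le> ball_max E x"
    unfolding ball_max_def using assms by (intro SUP_upper) auto
  have "emeasure lebesgue (E \<inter> ball x \<rho>)
      = ennreal (\<rho> ^ DIM('a)) * (emeasure lebesgue (E \<inter> ball x \<rho>) / ennreal (\<rho> ^ DIM('a)))"
    using assms by (simp add: ennreal_times_divide mult.commute[of "ennreal _"] mult_divide_eq_ennreal)
  also have "\<dots> \<le> ennreal (\<rho> ^ DIM('a)) * ball_max E x"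
    by (intro mult_left_mono *) auto
  finally show ?thesis .
qed

text \<open>If \<open>y\<close> is in the level set at height \<open>t\<close>, then
  \<open>x + y\<close> lies in some \<open>E i\<close>, where
  \<open>t * norm y ^ (2 * n) < (a i)\<^sup>2\<close>, that is, \<open>norm y < \<rho> i\<close>
  with \<open>\<rho> i ^ n = a i / sqrt t\<close>. So translates of the sets
  \<open>E i \<inter> ball x (\<rho> i)\<close> cover the level set, and each has measure at most
  \<open>\<rho> i ^ n\<close> times the maximal function.\<close>

lemma N_op_le:
  fixes f g :: "real^'n \<Rightarrow> complex" and a :: "nat \<Rightarrow> real"
  assumes E: "\<And>i. E i \<in> sets lebesgue" and a: "\<And>i. 0 < a i"
    and bound: "\<And>i z. z \<in> E i \<Longrightarrow> cmod (f z) * cmod (g z) \<le> (a i)\<^sup>2"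
    and cover: "\<And>z. f z \<noteq> 0 \<Longrightarrow> g z \<noteq> 0 \<Longrightarrow> \<exists>i. z \<in> E i"
  shows "N_op f g x \<le> (\<Sum>i. ennreal (a i) * ball_max (E i) x)\<^sup>2"
  unfolding N_op_def
proof (rule SUP_least)
  fix t :: real assume "t \<in> {0<..}"
  then have t: "0 < t" by simp
  let ?n = "CARD('n)"
  define Y where "Y = {y. y \<noteq> 0 \<and> cmod (f (x + y)) * cmod (g (x + y)) / norm y ^ (2 * ?n) > t}"
  define \<rho> where "\<rho> i = root ?n (a i / sqrt t)" for i
  have \<rho>: "0 < \<rho> i" "\<rho> i ^ ?n = a i / sqrt t" for i
    using a[of i] t by (auto simp: \<rho>_def real_root_gt_zero)
  define P where "P i = (+) (- x) ` (E i \<inter> ball x (\<rho> i))" for i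
  have P_sets: "P i \<in> sets lebesgue" for i
    unfolding P_def by (intro lebesgue_sets_translation sets.Int E) auto
  have P_meas: "emeasure lebesgue (P i) = emeasure lebesgue (E i \<inter> ball x (\<rho> i))" for i
    using emeasure_lebesgue_affine[of 1 "- x" "E i \<inter> ball x (\<rho> i)"] by (simp add: P_def)
  have "Y \<subseteq> (\<Union>i. P i)"
  proof
    fix y assume "y \<in> Y"
    then have y: "y \<noteq> 0" "t < cmod (f (x + y)) * cmod (g (x + y)) / norm y ^ (2 * ?n)" by (auto simp: Y_def)
    have "f (x + y) \<noteq> 0 \<and> g (x + y) \<noteq> 0" using y t by (intro conjI notI) auto
    then obtain i where i: "x + y \<in> E i" using cover by blast
    have "t * norm y ^ (2 * ?n) < cmod (f (x + y)) * cmod (g (x + y))"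
      using y by (simp add: pos_less_divide_eq)
    also have "\<dots> \<le> (a i)\<^sup>2" using bound[OF i] .
    finally have "(sqrt t * norm y ^ ?n)\<^sup>2 < (a i)\<^sup>2"
      using t by (simp add: power_mult_distrib power_mult[symmetric] mult.commute[of _ 2])
    then have "sqrt t * norm y ^ ?n < a i" using a[of i] power_less_imp_less_base less_imp_le by blast
    then have "norm y ^ ?n < \<rho> i ^ ?n" using t by (simp add: \<rho> pos_less_divide_eq mult.commute)
    then have "norm y < \<rho> i" using \<rho>(1)[of i] power_less_imp_less_base less_imp_le by blast
    then have "x + y \<in> E i \<inter> ball x (\<rho> i)" using i by (simp add: dist_norm)
    then have "- x + (x + y) \<in> P i" unfolding P_def by (rule imageI)
    then show "y \<in> (\<Union>i. P i)" by auto
  qed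
  then have "emeasure lebesgue Y \<le> emeasure lebesgue (\<Union>i. P i)"
    using P_sets by (intro emeasure_mono) auto
  also have "\<dots> \<le> (\<Sum>i. emeasure lebesgue (P i))"
    using P_sets by (intro emeasure_subadditive_countably) auto
  also have "\<dots> \<le> (\<Sum>i. ennreal (1 / sqrt t) * (ennreal (a i) * ball_max (E i) x))"
  proof (intro suminf_le summableI)
    fix i
    have "emeasure lebesgue (P i) \<le> ennreal (\<rho> i ^ ?n) * ball_max (E i) x"
      using emeasure_le_ball_max[OF \<rho>(1), of "E i" x i] by (simp add: P_meas)
    also have "ennreal (\<rho> i ^ ?n) = ennreal (1 / sqrt t) * ennreal (a i)"
      using t a[of i] by (simp add: \<rho> ennreal_mult[symmetric])
    finally show "emeasure lebesgue (P i) \<le> ennreal (1 / sqrt t) * (ennreal (a i) * ball_max (E i) x)"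
      by (simp add: mult.assoc)
  qed
  also have "\<dots> = ennreal (1 / sqrt t) * (\<Sum>i. ennreal (a i) * ball_max (E i) x)"
    by (rule ennreal_suminf_cmult)
  finally have "ennreal t * (emeasure lebesgue Y)\<^sup>2
      \<le> ennreal t * (ennreal (1 / sqrt t) * (\<Sum>i. ennreal (a i) * ball_max (E i) x))\<^sup>2"
    by (intro mult_left_mono power_mono) auto
  \<comment> \<open>The factor \<open>t\<close> cancels against the square of
    \<open>1 / sqrt t\<close>, which makes the bound uniform in the level.\<close>
  also have "\<dots> = (\<Sum>i. ennreal (a i) * ball_max (E i) x)\<^sup>2"
  proof -
    have "ennreal t * (ennreal (1 / sqrt t))\<^sup>2 = 1"
      using t by (simp add: ennreal_power ennreal_mult[symmetric] power_divide)
    then show ?thesis by (simp add: power_mult_distrib mult.assoc[symmetric])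
  qed
  finally show "ennreal t * (emeasure lebesgue {y. y \<noteq> 0 \<and> cmod (f (x + y)) * cmod (g (x + y)) / norm y ^ (2 * ?n) > t})\<^sup>2
      \<le> (\<Sum>i. ennreal (a i) * ball_max (E i) x)\<^sup>2"
    by (simp only: Y_def)
qed

section \<open>Dyadic form of the Lorentz quasi-norm\<close>

lemma ennpowr_ennreal: "0 \<le> x \<Longrightarrow> ennpowr (ennreal x) a = ennreal (x powr a)"
  by (simp add: ennpowr_def)

lemma ennpowr_mono:
  assumes "0 \<le> a" "x \<le> y"
  shows "ennpowr x a \<le> ennpowr y a"
proof (cases y)
  case (real r)
  then obtain s where "x = ennreal s" "0 \<le> s" "s \<le> r"
    using assms by (cases x) (auto simp: top_unique)
  then show ?thesis using real assms by (simp add: ennpowr_ennreal ennreal_leI powr_mono2)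
qed (simp add: ennpowr_def)

text \<open>On \<open>(2 powr (e - 1), 2 powr e]\<close> both \<open>s powr (\<alpha> - 1)\<close>
  and \<open>m s\<close> are smallest at the right end, and the interval has half the length of
  \<open>2 powr e\<close>, whence the factor 2. The integers are enumerated by
  \<open>int_decode\<close> so that the sum is a series over the naturals.\<close>

lemma dyadic_sum_le_integral:
  fixes m :: "real \<Rightarrow> ennreal"
  assumes \<alpha>: "0 < \<alpha>" "\<alpha> < 1" and m: "\<And>s t. 0 < s \<Longrightarrow> s \<le> t \<Longrightarrow> m t \<le> m s"
  shows "(\<Sum>k. ennreal ((2 powr real_of_int (int_decode k)) powr \<alpha>) * ennpowr (m (2 powr real_of_int (int_decode k))) \<alpha>)
     \<le> 2 * (\<integral>\<^sup>+s\<in>{0<..}. ennreal (s powr (\<alpha> - 1)) * ennpowr (m s) \<alpha> \<partial>lborel)"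
proof -
  define e where "e k = real_of_int (int_decode k)" for k
  define P where "P k = ennreal ((2 powr e k) powr (\<alpha> - 1)) * ennpowr (m (2 powr e k)) \<alpha>" for k
  define J where "J k = {2 powr (e k - 1)<..2 powr e k}" for k
  have pt: "(\<Sum>k. P k * indicator (J k) s) \<le> ennreal (s powr (\<alpha> - 1)) * ennpowr (m s) \<alpha> * indicator {0<..} s" for s
  proof (cases "0 < s")
    case True
    obtain j where j: "2 powr real_of_int j < s" "s \<le> 2 powr (real_of_int j + 1)"
      using dyadic_bracket[OF True] .
    \<comment> \<open>Only one interval contains \<open>s\<close>. Intervals are indexed by their
      right end, hence \<open>j + 1\<close>.\<close>
    define k where "k = int_encode (j + 1)"
    have ek: "e k = real_of_int j + 1" by (simp add: k_def e_def)
    have "(\<Sum>k. P k * indicator (J k) s) = (\<Sum>k\<in>{k}. P k * indicator (J k) s)"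
    proof (rule suminf_finite)
      fix k' assume "k' \<notin> {k}"
      have "int_decode k' \<noteq> j + 1" using \<open>k' \<notin> {k}\<close> by (metis int_decode_inverse k_def singletonI)
      then have "e k' \<le> real_of_int j \<or> real_of_int j + 1 \<le> e k' - 1" unfolding e_def by linarith
      then have "2 powr e k' \<le> 2 powr real_of_int j \<or> 2 powr (real_of_int j + 1) \<le> 2 powr (e k' - 1)" by simp
      then have "\<not> (2 powr (e k' - 1) < s \<and> s \<le> 2 powr e k')" using j by arith
      then show "P k' * indicator (J k') s = 0" by (simp add: J_def)
    qed simp
    also have "\<dots> = P k" using j by (simp add: J_def ek)
    also have "\<dots> \<le> ennreal (s powr (\<alpha> - 1)) * ennpowr (m s) \<alpha>"
      unfolding P_def using True j \<alpha>
      by (intro mult_mono ennreal_leI powr_mono2' ennpowr_mono m) (auto simp: ek)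
    finally show ?thesis using True by simp
  next
    case False
    have "s \<notin> J k" for k
    proof -
      have "0 < 2 powr (e k - 1)" by simp
      then show ?thesis using False unfolding J_def greaterThanAtMost_iff by linarith
    qed
    then show ?thesis by simp
  qed
  have "(\<Sum>k. P k * ennreal (2 powr (e k - 1))) = (\<Sum>k. \<integral>\<^sup>+s. P k * indicator (J k) s \<partial>lborel)"
  proof (intro suminf_cong)
    fix k
    have "2 powr e k - 2 powr (e k - 1) = 2 powr (e k - 1)" by (simp add: powr_diff)
    moreover have "2 powr (e k - 1) \<le> 2 powr e k" by simp
    ultimately show "P k * ennreal (2 powr (e k - 1)) = (\<integral>\<^sup>+s. P k * indicator (J k) s \<partial>lborel)"
      by (simp add: nn_integral_cmult_indicator J_def)
  qed
  also have "\<dots> = (\<integral>\<^sup>+s. (\<Sum>k. P k * indicator (J k) s) \<partial>lborel)"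
    by (intro nn_integral_suminf[symmetric]) (auto simp: J_def)
  also have "\<dots> \<le> (\<integral>\<^sup>+s\<in>{0<..}. ennreal (s powr (\<alpha> - 1)) * ennpowr (m s) \<alpha> \<partial>lborel)"
    by (intro nn_integral_mono pt)
  finally have *: "(\<Sum>k. P k * ennreal (2 powr (e k - 1))) \<le> (\<integral>\<^sup>+s\<in>{0<..}. ennreal (s powr (\<alpha> - 1)) * ennpowr (m s) \<alpha> \<partial>lborel)" .
  have "ennreal ((2 powr e k) powr \<alpha>) * ennpowr (m (2 powr e k)) \<alpha> = 2 * (P k * ennreal (2 powr (e k - 1)))" for k
  proof -
    have "(2 powr e k) powr \<alpha> = 2 * ((2 powr e k) powr (\<alpha> - 1) * 2 powr (e k - 1))"
      by (simp add: powr_diff)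
    then have "ennreal ((2 powr e k) powr \<alpha>) = 2 * (ennreal ((2 powr e k) powr (\<alpha> - 1)) * ennreal (2 powr (e k - 1)))"
      by (simp add: ennreal_mult)
    then show ?thesis by (simp add: P_def ac_simps)
  qed
  then have "(\<Sum>k. ennreal ((2 powr e k) powr \<alpha>) * ennpowr (m (2 powr e k)) \<alpha>) = 2 * (\<Sum>k. P k * ennreal (2 powr (e k - 1)))"
    by simp
  also have "\<dots> \<le> 2 * (\<integral>\<^sup>+s\<in>{0<..}. ennreal (s powr (\<alpha> - 1)) * ennpowr (m s) \<alpha> \<partial>lborel)"
    by (intro mult_left_mono *) auto
  finally show ?thesis unfolding e_def .
qed

text \<open>For \<open>p = 1\<close> the integral equals \<open>L powr \<alpha>\<close>. Each term
  of the dyadic sum is then finite, so every dyadic superlevel set has finite measure and the terms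
  can be handled as real numbers.\<close>

lemma lorentz_dyadic:
  fixes w :: "real^'n \<Rightarrow> real" and F :: "real^'n \<Rightarrow> ennreal"
  assumes \<alpha>: "0 < \<alpha>" "\<alpha> < 1" and F: "F \<in> borel_measurable lebesgue"
    and L: "lorentz 1 \<alpha> w F = ennreal L" "0 \<le> L"
  defines "m \<equiv> \<lambda>s. emeasure (weight_measure w) {x. ennreal s < F x}"
  shows "m (2 powr real_of_int j) < \<infinity>"
    and "(\<Sum>k. ennreal ((2 powr real_of_int (int_decode k) * enn2real (m (2 powr real_of_int (int_decode k)))) powr \<alpha>))
           \<le> ennreal (2 * L powr \<alpha>)"
proof -
  define I where "I = (\<integral>\<^sup>+s\<in>{0<..}. ennreal (s powr (\<alpha> - 1)) * ennpowr (m s) \<alpha> \<partial>lborel)"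
  let ?b = "\<lambda>k. ennreal ((2 powr real_of_int (int_decode k)) powr \<alpha>) * ennpowr (m (2 powr real_of_int (int_decode k))) \<alpha>"
  have LI: "ennpowr I (1 / \<alpha>) = ennreal L"
    using L(1) by (simp add: lorentz_def I_def m_def)
  then have "I \<noteq> \<infinity>" by (auto simp: ennpowr_def)
  then obtain i where i: "I = ennreal i" "0 \<le> i" by (cases I) auto
  have "i powr (1 / \<alpha>) = L" using LI i L by (simp add: ennpowr_ennreal)
  then have "i = L powr \<alpha>" using i \<alpha> by (auto simp: powr_powr)
  have F_sets: "{x. ennreal s < F x} \<in> sets lebesgue" for s
    using borel_measurable_less[OF borel_measurable_const F] by simp
  have "m t \<le> m s" if "0 < s" "s \<le> t" for s t
    unfolding m_def using that
    by (intro emeasure_mono) (auto intro: le_less_trans ennreal_leI simp: F_sets)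
  from dyadic_sum_le_integral[where m = m, OF \<alpha> this]
  have le: "(\<Sum>k. ?b k) \<le> ennreal (2 * L powr \<alpha>)"
    using \<open>i = _\<close> i by (simp add: I_def[symmetric] ennreal_mult)
  have fin: "m (2 powr real_of_int j) < \<infinity>" for j
  proof -
    have "?b (int_encode j) \<le> ennreal (2 * L powr \<alpha>)"
      by (rule order_trans[OF term_le_suminf_ennreal le])
    then show ?thesis
      by (auto simp: ennpowr_def ennreal_mult_top top_unique less_top split: if_splits)
  qed
  show "m (2 powr real_of_int j) < \<infinity>" by (rule fin)
  have "ennreal ((2 powr real_of_int (int_decode k) * enn2real (m (2 powr real_of_int (int_decode k)))) powr \<alpha>) = ?b k" for k
    using fin[of "int_decode k"] by (simp add: powr_mult ennreal_mult ennpowr_def less_top)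
  then show "(\<Sum>k. ennreal ((2 powr real_of_int (int_decode k) * enn2real (m (2 powr real_of_int (int_decode k)))) powr \<alpha>))
           \<le> ennreal (2 * L powr \<alpha>)" using le by simp
qed

section \<open>The weak type estimate for \<open>N_op\<close>\<close>

text \<open>The main estimate for normalized data: \<open>B1 * \<beta>1 k\<close> and
  \<open>B2 * \<beta>2 k\<close> dominate the dyadic terms of the two quasi-norms. The products of
  the \<open>\<beta>1\<close> and \<open>\<beta>2\<close> form the sequence \<open>c\<close> of
  \<open>weak_type_suminf\<close>, which must be positive with sum at most 1; so the
  \<open>\<beta>\<close> are positive even where level sets are null.\<close>

lemma weak_lorentz_N_op_le:
  fixes q K B1 B2 :: real and v1 v2 :: "real^'n \<Rightarrow> real" and f1 f2 :: "real^'n \<Rightarrow> complex"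
    and \<beta>1 \<beta>2 :: "nat \<Rightarrow> real"
  defines "W \<equiv> weight_measure (geom_weight v1 v2)"
    and "m1 \<equiv> \<lambda>j::int. emeasure (weight_measure v1) {x. ennreal (2 powr real_of_int j) < ennreal (cmod (f1 x))}"
    and "m2 \<equiv> \<lambda>j::int. emeasure (weight_measure v2) {x. ennreal (2 powr real_of_int j) < ennreal (cmod (f2 x))}"
  assumes q: "1 < q" and v: "is_weight v1" "is_weight v2"
    and K: "0 < K" "\<And>Q F. Q \<in> cubes \<Longrightarrow> F \<in> sets lebesgue \<Longrightarrow> F \<subseteq> Q \<Longrightarrow>
        emeasure W Q * emeasure lebesgue F \<le> ennreal K * emeasure lebesgue Q * emeasure W F"
    and f1[measurable]: "f1 \<in> borel_measurable lebesgue" and f2[measurable]: "f2 \<in> borel_measurable lebesgue"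
    and fin: "\<And>j. m1 j < \<infinity>" "\<And>j. m2 j < \<infinity>"
    and B: "0 < B1" "0 < B2"
    and \<beta>: "\<And>k. 0 < \<beta>1 k" "\<And>k. 0 < \<beta>2 k" "(\<Sum>k. ennreal (\<beta>1 k)) \<le> 1" "(\<Sum>k. ennreal (\<beta>2 k)) \<le> 1"
    and bound1: "\<And>k. (2 powr real_of_int (int_decode k) * enn2real (m1 (int_decode k))) powr (1 / (2 * q)) \<le> B1 * \<beta>1 k"
    and bound2: "\<And>k. (2 powr real_of_int (int_decode k) * enn2real (m2 (int_decode k))) powr (1 / (2 * q)) \<le> B2 * \<beta>2 k"
  shows "weak_lorentz (1/2) (geom_weight v1 v2) (N_op f1 f2)
    \<le> ennreal (((1 + 2 powr (q + 1) / (1 - 2 powr (1 - q))) * (2 * (K * 10 ^ CARD('n)) * (B1 * B2) powr q))\<^sup>2)"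
proof -
  define D where "D = 1 + 2 powr (q + 1) / (1 - 2 powr (1 - q))"
  have "2 powr (1 - q) < 1" using q powr_less_mono[of "1 - q" 0 2] by simp
  then have D: "0 < D" by (simp add: D_def add_pos_nonneg)
  define K' where "K' = K * 10 ^ CARD('n)"
  have K': "0 < K'" using K by (simp add: K'_def)
  \<comment> \<open>Dividing by \<open>A\<close> makes the weak type bound of the scaled maximal
    functions \<open>g i\<close> below exactly \<open>c i powr q / t\<close>.\<close>
  define A where "A = 2 * K' * (B1 * B2) powr q"
  have A: "0 < A" using K' B by (simp add: A_def)
  \<comment> \<open>One natural index \<open>i\<close> encodes the pair of dyadic levels of
    \<open>f1\<close> and \<open>f2\<close>.\<close>
  define j1 where "j1 i = int_decode (fst (prod_decode i))" for i
  define j2 where "j2 i = int_decode (snd (prod_decode i))" for i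
  define E where "E i = {x. 2 powr real_of_int (j1 i) < cmod (f1 x) \<and> cmod (f1 x) \<le> 2 powr (real_of_int (j1 i) + 1)
      \<and> 2 powr real_of_int (j2 i) < cmod (f2 x) \<and> cmod (f2 x) \<le> 2 powr (real_of_int (j2 i) + 1)}" for i
  \<comment> \<open>On \<open>E i\<close> each modulus is at most twice its lower level, so the
    square root of their product is at most \<open>a i\<close>.\<close>
  define a where "a i = 2 * sqrt (2 powr real_of_int (j1 i) * 2 powr real_of_int (j2 i))" for i
  define c where "c i = \<beta>1 (fst (prod_decode i)) * \<beta>2 (snd (prod_decode i))" for i
  have n: "(\<lambda>x. cmod (f1 x)) \<in> borel_measurable lebesgue" "(\<lambda>x. cmod (f2 x)) \<in> borel_measurable lebesgue"
    using f1 f2 by (auto intro: borel_measurable_norm)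
  have level_sets: "{x. r < cmod (f1 x)} \<in> sets lebesgue" "{x. cmod (f1 x) \<le> r} \<in> sets lebesgue"
    "{x. r < cmod (f2 x)} \<in> sets lebesgue" "{x. cmod (f2 x) \<le> r} \<in> sets lebesgue" for r
    using n[THEN borel_measurable_less[OF borel_measurable_const], of r]
      n[THEN borel_measurable_le[OF _ borel_measurable_const], of r] by simp_all
  then have E_sets: "E i \<in> sets lebesgue" for i
    unfolding E_def Collect_conj_eq by (intro sets.Int)
  have a: "0 < a i" for i by (simp add: a_def)
  have c: "0 < c i" for i using \<beta> by (simp add: c_def)
  have sum_c: "(\<Sum>i. ennreal (c i)) \<le> 1"
  proof -
    have "(\<Sum>i. ennreal (c i)) = (\<Sum>i. (\<lambda>(k, l). ennreal (\<beta>1 k) * ennreal (\<beta>2 l)) (prod_decode i))"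
      using \<beta> by (simp add: c_def case_prod_beta ennreal_mult less_imp_le)
    also have "\<dots> = (\<Sum>k. \<Sum>l. ennreal (\<beta>1 k) * ennreal (\<beta>2 l))"
      by (intro suminf_ennreal_2dimen) simp
    also have "\<dots> = (\<Sum>k. ennreal (\<beta>1 k)) * (\<Sum>l. ennreal (\<beta>2 l))"
      by simp
    also have "\<dots> \<le> 1 * 1" by (intro mult_mono \<beta>) auto
    finally show ?thesis by simp
  qed
  have N_le: "N_op f1 f2 x \<le> (\<Sum>i. ennreal (a i) * ball_max (E i) x)\<^sup>2" for x
  proof (rule N_op_le[OF E_sets a])
    fix i z assume "z \<in> E i"
    then have "cmod (f1 z) * cmod (f2 z) \<le> 2 powr (real_of_int (j1 i) + 1) * 2 powr (real_of_int (j2 i) + 1)"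
      by (intro mult_mono) (auto simp: E_def)
    then show "cmod (f1 z) * cmod (f2 z) \<le> (a i)\<^sup>2"
      by (simp add: a_def power_mult_distrib powr_add)
  next
    fix z assume "f1 z \<noteq> 0" "f2 z \<noteq> 0"
    then obtain i j :: int where
      "2 powr real_of_int i < cmod (f1 z)" "cmod (f1 z) \<le> 2 powr (real_of_int i + 1)"
      "2 powr real_of_int j < cmod (f2 z)" "cmod (f2 z) \<le> 2 powr (real_of_int j + 1)"
      by (metis dyadic_bracket zero_less_norm_iff)
    then have "z \<in> E (prod_encode (int_encode i, int_encode j))"
      by (simp add: E_def j1_def j2_def)
    then show "\<exists>i. z \<in> E i" by blast
  qed
  \<comment> \<open>The source of the exponent \<open>1 / (2 * q)\<close>: the Cauchy-Schwarz square
    root is the \<open>q\<close>-th power of a product of \<open>1 / (2 * q)\<close>-th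
    powers.\<close>
  have sqrt_eq: "sqrt (X * Y) = (X powr (1 / (2 * q)) * Y powr (1 / (2 * q))) powr q" if "0 \<le> X" "0 \<le> Y" for X Y
    using that q by (simp add: powr_mult powr_powr powr_half_sqrt real_sqrt_mult)
  have WE: "a i * enn2real (emeasure W (E i)) \<le> 2 * (B1 * B2) powr q * c i powr q" "emeasure W (E i) < \<infinity>" for i
  proof -
    let ?m1 = "enn2real (m1 (j1 i))" and ?m2 = "enn2real (m2 (j2 i))"
    have "(emeasure W (E i))\<^sup>2 \<le> emeasure (weight_measure v1) (E i) * emeasure (weight_measure v2) (E i)"
      unfolding W_def by (intro geom_weight_measure_le v E_sets)
    \<comment> \<open>Only the lower ends of the brackets enter: \<open>E i\<close> lies in both
      superlevel sets.\<close>
    also have "\<dots> \<le> m1 (j1 i) * m2 (j2 i)"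
      unfolding m1_def m2_def
      by (intro mult_mono emeasure_mono) (auto simp: E_def ennreal_less_iff level_sets)
    also have "\<dots> = ennreal (?m1 * ?m2)"
      using fin by (simp add: ennreal_mult less_top)
    finally have sq: "(emeasure W (E i))\<^sup>2 \<le> ennreal (?m1 * ?m2)" .
    then show finE: "emeasure W (E i) < \<infinity>"
      by (auto simp: power2_eq_square ennreal_top_mult top_unique less_top[symmetric])
    then obtain u where u: "emeasure W (E i) = ennreal u" "0 \<le> u"
      by (cases "emeasure W (E i)") auto
    have "u\<^sup>2 \<le> ?m1 * ?m2" using sq u by (simp add: ennreal_power)
    then have "u \<le> sqrt (?m1 * ?m2)" by (rule real_le_rsqrt)
    then have "a i * u \<le> a i * sqrt (?m1 * ?m2)" using a[of i] by simp
    also have "\<dots> = 2 * sqrt ((2 powr real_of_int (j1 i) * ?m1) * (2 powr real_of_int (j2 i) * ?m2))"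
      unfolding a_def by (simp add: real_sqrt_mult ac_simps)
    also have "\<dots> = 2 * (((2 powr real_of_int (j1 i) * ?m1) powr (1 / (2 * q))) * ((2 powr real_of_int (j2 i) * ?m2) powr (1 / (2 * q)))) powr q"
      by (subst sqrt_eq) auto
    also have "\<dots> \<le> 2 * ((B1 * \<beta>1 (fst (prod_decode i))) * (B2 * \<beta>2 (snd (prod_decode i)))) powr q"
      using bound1[of "fst (prod_decode i)"] bound2[of "snd (prod_decode i)"] B \<beta>(1)[of "fst (prod_decode i)"] q
      unfolding j1_def j2_def
      by (intro mult_left_mono powr_mono2 mult_mono) (auto simp: less_imp_le)
    also have "\<dots> = 2 * (B1 * B2) powr q * c i powr q"
      by (simp add: c_def powr_mult)
    finally show "a i * enn2real (emeasure W (E i)) \<le> 2 * (B1 * B2) powr q * c i powr q" using u by simp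
  qed
  define g where "g i x = ennreal (a i / A) * ball_max (E i) x" for i x
  have [measurable]: "ball_max (E i) \<in> borel_measurable W" for i
    using ball_max_measurable[OF E_sets[of i]] by (simp add: W_def measurable_completion measurable_def)
  have g_meas: "g i \<in> borel_measurable W" for i unfolding g_def by measurable
  have weak: "emeasure W {x \<in> space W. ennreal t < g i x} \<le> ennreal (c i powr q / t)" if t: "0 < t" for i t
  proof -
    have "ennreal t < g i x \<longleftrightarrow> ennreal (t * A / a i) < ball_max (E i) x" for x
    proof (cases "ball_max (E i) x")
      case (real r)
      then show ?thesis using a[of i] A t
        by (simp add: g_def ennreal_mult[symmetric] ennreal_less_iff field_simps)
    next
      case top
      then show ?thesis using a[of i] A t by (simp add: g_def ennreal_mult_top)
    qed
    then have "emeasure W {x \<in> space W. ennreal t < g i x} = emeasure W {x. ennreal (t * A / a i) < ball_max (E i) x}"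
      by (simp add: W_def)
    also have "\<dots> \<le> ennreal (K * 10 ^ CARD('n) / (t * A / a i)) * emeasure W (E i)"
      using a[of i] A t K by (intro ball_max_weak_type E_sets K) (auto simp: W_def)
    also have "\<dots> = ennreal (K' / (t * A) * (a i * enn2real (emeasure W (E i))))"
    proof -
      obtain u where "emeasure W (E i) = ennreal u" "0 \<le> u"
        using WE(2)[of i] by (cases "emeasure W (E i)") auto
      then show ?thesis using a[of i] A t K' by (simp add: K'_def[symmetric] ennreal_mult'[symmetric])
    qed
    also have "\<dots> \<le> ennreal (K' / (t * A) * (2 * (B1 * B2) powr q * c i powr q))"
      using A t K' by (intro ennreal_leI mult_left_mono WE) auto
    also have "K' / (t * A) * (2 * (B1 * B2) powr q * c i powr q) = c i powr q / t"
    proof -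
      have "K' / (t * A) * (2 * (B1 * B2) powr q * c i powr q) = A / (t * A) * c i powr q"
        by (simp add: A_def)
      then show ?thesis using A by simp
    qed
    finally show ?thesis .
  qed
  have level: "emeasure W {x \<in> space W. ennreal s < (\<Sum>i. g i x)} \<le> ennreal (D / s)" if "0 < s" for s
    unfolding D_def by (rule weak_type_suminf[OF q that g_meas c sum_c weak])
  have "ennreal t * ennpowr (emeasure W {x. ennreal t < N_op f1 f2 x}) (1 / (1/2)) \<le> ennreal ((D * A)\<^sup>2)"
    if t: "0 < t" for t
  proof -
    \<comment> \<open>\<open>N_op\<close> is at most the square of \<open>A\<close> times the sum of
      the \<open>g i\<close>, so exceeding \<open>t\<close> forces that sum above
      \<open>sqrt t / A\<close>.\<close>
    have sub: "{x. ennreal t < N_op f1 f2 x} \<subseteq> {x \<in> space W. ennreal (sqrt t / A) < (\<Sum>i. g i x)}"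
    proof safe
      fix x assume x: "ennreal t < N_op f1 f2 x"
      show "ennreal (sqrt t / A) < (\<Sum>i. g i x)"
      proof (rule ccontr)
        assume "\<not> ?thesis"
        then have le: "(\<Sum>i. g i x) \<le> ennreal (sqrt t / A)" by simp
        have "(\<Sum>i. ennreal (a i) * ball_max (E i) x) = ennreal A * (\<Sum>i. g i x)"
        proof -
          have "ennreal (a i) = ennreal A * ennreal (a i / A)" for i
            using A a[of i] by (simp add: ennreal_mult[symmetric])
          then show ?thesis unfolding g_def ennreal_suminf_cmult[symmetric] by (simp add: mult.assoc)
        qed
        also have "\<dots> \<le> ennreal A * ennreal (sqrt t / A)" by (intro mult_left_mono le) auto
        also have "\<dots> = ennreal (sqrt t)" using A t by (simp add: ennreal_mult[symmetric])
        finally have "(\<Sum>i. ennreal (a i) * ball_max (E i) x)\<^sup>2 \<le> (ennreal (sqrt t))\<^sup>2"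
          by (intro power_mono) auto
        also have "\<dots> = ennreal t" using t by (simp add: ennreal_power)
        finally show False using N_le[of x] x by auto
      qed
    qed (simp add: W_def)
    have "emeasure W {x. ennreal t < N_op f1 f2 x} \<le> emeasure W {x \<in> space W. ennreal (sqrt t / A) < (\<Sum>i. g i x)}"
      using g_meas by (intro emeasure_mono sub) measurable
    also have "\<dots> \<le> ennreal (D / (sqrt t / A))"
      using t A by (intro level) auto
    finally have "ennpowr (emeasure W {x. ennreal t < N_op f1 f2 x}) (1 / (1/2)) \<le> ennpowr (ennreal (D / (sqrt t / A))) (1 / (1/2))"
      by (intro ennpowr_mono) auto
    also have "\<dots> = ennreal ((D * A)\<^sup>2 / t)"
      using D A t by (simp add: ennpowr_ennreal power_divide)
    finally have "ennreal t * ennpowr (emeasure W {x. ennreal t < N_op f1 f2 x}) (1 / (1/2)) \<le> ennreal t * ennreal ((D * A)\<^sup>2 / t)"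
      by (intro mult_left_mono) auto
    also have "\<dots> = ennreal ((D * A)\<^sup>2)" using t by (simp add: ennreal_mult[symmetric])
    finally show ?thesis .
  qed
  then show ?thesis
    unfolding weak_lorentz_def W_def[symmetric] D_def[symmetric] K'_def[symmetric] A_def[symmetric]
    by (intro SUP_least) auto
qed

text \<open>Adding a geometric sequence of total \<open>\<epsilon>\<close> makes all terms positive
  and the normalizing constant nonzero, even when \<open>b\<close> vanishes identically.\<close>

lemma dominating_positive_sequence:
  fixes b :: "nat \<Rightarrow> real"
  assumes b: "\<And>k. 0 \<le> b k" and sum_b: "(\<Sum>k. ennreal (b k)) \<le> ennreal S" and S: "0 \<le> S" and \<epsilon>: "0 < \<epsilon>"
  obtains \<beta> :: "nat \<Rightarrow> real" where "\<And>k. 0 < \<beta> k" "(\<Sum>k. ennreal (\<beta> k)) \<le> 1" "\<And>k. b k \<le> (S + \<epsilon>) * \<beta> k"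
proof
  let ?\<beta> = "\<lambda>k. (b k + \<epsilon> * (1/2) ^ Suc k) / (S + \<epsilon>)"
  show "0 < ?\<beta> k" for k using b[of k] S \<epsilon> by (intro divide_pos_pos add_nonneg_pos) auto
  show "b k \<le> (S + \<epsilon>) * ?\<beta> k" for k using S \<epsilon> by simp
  have "(\<Sum>k. ennreal (?\<beta> k)) = (\<Sum>k. ennreal (1 / (S + \<epsilon>)) * (ennreal (b k) + ennreal (\<epsilon> * (1/2) ^ Suc k)))"
    using b S \<epsilon> by (intro suminf_cong)
      (simp add: ennreal_plus[symmetric] ennreal_mult[symmetric] del: ennreal_plus power_Suc)
  also have "\<dots> = ennreal (1 / (S + \<epsilon>)) * ((\<Sum>k. ennreal (b k)) + (\<Sum>k. ennreal (\<epsilon> * (1/2) ^ Suc k)))"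
    by (simp add: suminf_add summableI del: power_Suc)
  also have "(\<Sum>k. ennreal (\<epsilon> * (1/2) ^ Suc k)) = ennreal (\<epsilon> * 1)"
    using \<epsilon> by (intro suminf_ennreal_eq sums_mult power_half_series) auto
  also have "ennreal (1 / (S + \<epsilon>)) * ((\<Sum>k. ennreal (b k)) + ennreal (\<epsilon> * 1)) \<le> ennreal (1 / (S + \<epsilon>)) * (ennreal S + ennreal (\<epsilon> * 1))"
    by (intro mult_left_mono add_mono sum_b) auto
  also have "\<dots> = 1"
    using S \<epsilon> by (simp add: ennreal_plus[symmetric] ennreal_mult[symmetric] del: ennreal_plus)
  finally show "(\<Sum>k. ennreal (?\<beta> k)) \<le> 1" .
qed

theorem corollary4p2:
  fixes q :: real and v1 v2 :: "real^'n \<Rightarrow> real"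
  assumes "q > 1" and "A_half v1 v2"
  shows "\<exists>C::real. C > 0 \<and>
    (\<forall>f1 f2 :: real^'n \<Rightarrow> complex.
       f1 \<in> borel_measurable lebesgue \<longrightarrow> f2 \<in> borel_measurable lebesgue \<longrightarrow>
       weak_lorentz (1/2) (geom_weight v1 v2) (N_op f1 f2)
         \<le> ennreal C * times_inf (lorentz 1 (1 / (2 * q)) v1 (\<lambda>x. ennreal (cmod (f1 x))))
                                  (lorentz 1 (1 / (2 * q)) v2 (\<lambda>x. ennreal (cmod (f2 x)))))"
proof -
  let ?\<alpha> = "1 / (2 * q)"
  have q: "1 < q" and \<alpha>: "0 < ?\<alpha>" "?\<alpha> < 1" using assms(1) by auto
  have v: "is_weight v1" "is_weight v2" using assms(2) by (auto simp: A_half_def)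
  let ?W = "weight_measure (geom_weight v1 v2)"
  obtain K0 where K0: "0 \<le> K0" "\<And>Q F. Q \<in> cubes \<Longrightarrow> F \<in> sets lebesgue \<Longrightarrow> F \<subseteq> Q \<Longrightarrow>
      emeasure ?W Q * emeasure lebesgue F \<le> ennreal K0 * emeasure lebesgue Q * emeasure ?W F"
    using A_half_imp_A1[OF assms(2)] by blast
  \<comment> \<open>\<open>K0\<close> may be 0; a positive \<open>K\<close> keeps the final constant
    positive.\<close>
  define K where "K = K0 + 1"
  have K: "0 < K" using K0 by (simp add: K_def)
  have K_A1: "emeasure ?W Q * emeasure lebesgue F \<le> ennreal K * emeasure lebesgue Q * emeasure ?W F"
    if "Q \<in> cubes" "F \<in> sets lebesgue" "F \<subseteq> Q" for Q F
    by (rule order_trans[OF K0(2)[OF that]]) (auto intro!: mult_right_mono ennreal_leI simp: K_def)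
  define c where "c = (1 + 2 powr (q + 1) / (1 - 2 powr (1 - q))) * (2 * (K * 10 ^ CARD('n)))"
  have "2 powr (1 - q) < 1" using q powr_less_mono[of "1 - q" 0 2] by simp
  then have c: "0 < c" using K by (simp add: c_def add_pos_nonneg)
  \<comment> \<open>Each dyadic sum costs a factor 2; their product 4 is raised to the power
    \<open>q\<close> and then squared.\<close>
  define C where "C = c\<^sup>2 * 4 powr (2 * q)"
  have C: "0 < C" using c by (simp add: C_def)
  show ?thesis
  proof (intro exI[of _ C] conjI C allI impI)
    fix f1 f2 :: "real^'n \<Rightarrow> complex"
    assume f: "f1 \<in> borel_measurable lebesgue" "f2 \<in> borel_measurable lebesgue"
    let ?X = "weak_lorentz (1/2) (geom_weight v1 v2) (N_op f1 f2)"
    let ?l1 = "lorentz 1 ?\<alpha> v1 (\<lambda>x. ennreal (cmod (f1 x)))"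
    let ?l2 = "lorentz 1 ?\<alpha> v2 (\<lambda>x. ennreal (cmod (f2 x)))"
    show "?X \<le> ennreal C * times_inf ?l1 ?l2"
    \<comment> \<open>An infinite quasi-norm makes the right side infinite even if the other one
      vanishes, by the convention in \<open>times_inf\<close>.\<close>
    proof (cases "?l1 = \<infinity> \<or> ?l2 = \<infinity>")
      case True
      then show ?thesis using C by (simp add: times_inf_def ennreal_mult_top)
    next
      case False
      then obtain L1 L2 where L: "?l1 = ennreal L1" "0 \<le> L1" "?l2 = ennreal L2" "0 \<le> L2"
        by (cases ?l1; cases ?l2) auto
      have F: "(\<lambda>x. ennreal (cmod (f1 x))) \<in> borel_measurable lebesgue"
        "(\<lambda>x. ennreal (cmod (f2 x))) \<in> borel_measurable lebesgue"
        using f by (auto intro!: measurable_compose[OF _ measurable_ennreal] borel_measurable_norm)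
      note d1 = lorentz_dyadic[OF \<alpha> F(1) L(1,2)] and d2 = lorentz_dyadic[OF \<alpha> F(2) L(3,4)]
      have eps: "?X \<le> ennreal ((c * ((2 * L1 powr ?\<alpha> + \<epsilon>) * (2 * L2 powr ?\<alpha> + \<epsilon>)) powr q)\<^sup>2)"
        if \<epsilon>: "0 < \<epsilon>" for \<epsilon>
      proof -
        obtain \<beta>1 where \<beta>1: "\<And>k. 0 < \<beta>1 k" "(\<Sum>k. ennreal (\<beta>1 k)) \<le> 1"
          "\<And>k. (2 powr real_of_int (int_decode k) * enn2real (emeasure (weight_measure v1)
              {x. ennreal (2 powr real_of_int (int_decode k)) < ennreal (cmod (f1 x))})) powr ?\<alpha>
            \<le> (2 * L1 powr ?\<alpha> + \<epsilon>) * \<beta>1 k"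
          by (rule dominating_positive_sequence[OF _ d1(2) _ \<epsilon>]) auto
        obtain \<beta>2 where \<beta>2: "\<And>k. 0 < \<beta>2 k" "(\<Sum>k. ennreal (\<beta>2 k)) \<le> 1"
          "\<And>k. (2 powr real_of_int (int_decode k) * enn2real (emeasure (weight_measure v2)
              {x. ennreal (2 powr real_of_int (int_decode k)) < ennreal (cmod (f2 x))})) powr ?\<alpha>
            \<le> (2 * L2 powr ?\<alpha> + \<epsilon>) * \<beta>2 k"
          by (rule dominating_positive_sequence[OF _ d2(2) _ \<epsilon>]) auto
        have pos: "0 < 2 * L1 powr ?\<alpha> + \<epsilon>" "0 < 2 * L2 powr ?\<alpha> + \<epsilon>"
          using \<epsilon> by (auto intro: add_nonneg_pos)
        show ?thesis
          using weak_lorentz_N_op_le[OF q v K K_A1 f d1(1) d2(1) pos \<beta>1(1) \<beta>2(1) \<beta>1(2) \<beta>2(2) \<beta>1(3) \<beta>2(3)]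
          by (simp only: c_def mult.assoc)
      qed
      \<comment> \<open>Letting \<open>\<epsilon>\<close> tend to 0 removes the perturbation. If
        \<open>L1\<close> or \<open>L2\<close> is 0, the base of the power tends to 0, and
        continuity there rests on \<open>q\<close> being positive.\<close>
      have "((\<lambda>\<epsilon>. ennreal ((c * ((2 * L1 powr ?\<alpha> + \<epsilon>) * (2 * L2 powr ?\<alpha> + \<epsilon>)) powr q)\<^sup>2))
          \<longlongrightarrow> ennreal ((c * ((2 * L1 powr ?\<alpha> + 0) * (2 * L2 powr ?\<alpha> + 0)) powr q)\<^sup>2)) (at_right 0)"
        using q by (intro tendsto_ennrealI tendsto_intros tendsto_powr')
          (auto intro!: eventually_at_right_less[THEN eventually_mono])
      moreover have "\<forall>\<^sub>F \<epsilon> in at_right 0. ?X \<le> ennreal ((c * ((2 * L1 powr ?\<alpha> + \<epsilon>) * (2 * L2 powr ?\<alpha> + \<epsilon>)) powr q)\<^sup>2)"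
        using eps by (intro eventually_at_right_less[THEN eventually_mono])
      ultimately have "?X \<le> ennreal ((c * ((2 * L1 powr ?\<alpha> + 0) * (2 * L2 powr ?\<alpha> + 0)) powr q)\<^sup>2)"
        by (rule tendsto_lowerbound) simp
      also have "(c * ((2 * L1 powr ?\<alpha> + 0) * (2 * L2 powr ?\<alpha> + 0)) powr q)\<^sup>2 = C * (L1 * L2)"
      proof -
        have sq: "(x powr q)\<^sup>2 = x powr (2 * q)" for x :: real
          by (simp add: power2_eq_square powr_add[symmetric])
        have "(2 * L1 powr ?\<alpha> + 0) * (2 * L2 powr ?\<alpha> + 0) = 4 * (L1 powr ?\<alpha> * L2 powr ?\<alpha>)" by simp
        then show ?thesis
          using q L by (simp only: power_mult_distrib sq) (simp add: C_def powr_mult powr_powr)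
      qed
      finally show ?thesis
        using L C by (simp add: times_inf_def ennreal_mult)
    qed
  qed
qed

end
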